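(* Let $n\ge1$, let $\alpha_0,\dots,\alpha_{n-1}\in\mathbb{C}$ and let $A=\sum_{i=0}^{n-1}\alpha_iS^i\in M_n(\mathbb{C})$, where $S$ is the $n\times n$ cyclic shift matrix. Then $A\in LA(n)$ if and only if there exists $\omega\in\mathbb{C}$ with $\omega^n=1$ such that $$A=\beta\,C(|\alpha_0|,\omega|\alpha_1|,\omega^2|\alpha_2|,\dots,\omega^{n-1}|\alpha_{n-1}|)$$ for some $\beta\in\mathbb{C}$ with $|\beta|=1$. In particular, $A\in LA(n)$ implies $\|A\|_{p,p}=\sum_{i=0}^{n-1}|\alpha_i|$ for every $p\in[1,\infty]$.
   Context: For $\xi=(x_1,\dots,x_n)\in\mathbb{C}^n$, $\|\xi\|_p=(\sum_{i=1}^n|x_i|^p)^{1/p}$ for $1\le p<\infty$ and $\|\xi\|_\infty=\max_i|x_i|$. For $A\in M_n(\mathbb{C})$, $\|A\|_{p,p}=\sup\{\|A\xi\|_p:\|\xi\|_p=1\}$. A matrix $A\in M_n(\mathbb{C})$ is called logarithmic affine, written $A\in LA(n)$, if $\|A\|_{p,p}=\|A\|_{1,1}^{1/p}\|A\|_{\infty,\infty}^{1-1/p}$ for every $p\in[1,\infty]$ (with $1/\infty=0$ and $0^0=1$). The cyclic shift $S\in M_n(\mathbb{C})$ is the permutation matrix with entries $1$ at positions $(i,i+1)$ for $1\le i\le n-1$ and at $(n,1)$, and $0$ elsewhere; $S^0=I_n$. For $\gamma_0,\dots,\gamma_{n-1}\in\mathbb{C}$, the circulant matrix is $C(\gamma_0,\gamma_1,\dots,\gamma_{n-1})=\sum_{i=0}^{n-1}\gamma_iS^i$,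 i.e. the matrix with first row $(\gamma_0,\gamma_1,\dots,\gamma_{n-1})$ in which each subsequent row is the cyclic right shift of the previous one. *)

theory Defs
  imports
    Complex_Main
    "HOL-Library.Extended_Real"
    "Jordan_Normal_Form.Matrix"
begin

definition lp_norm :: "ereal \<Rightarrow> complex vec \<Rightarrow> real" where
  "lp_norm p v =
     (if p = \<infinity> then Max ((\<lambda>i. cmod (v $ i)) ` {..<dim_vec v})
      else (\<Sum>i<dim_vec v. cmod (v $ i) powr real_of_ereal p) powr (1 / real_of_ereal p))"

definition lp_op_norm :: "ereal \<Rightarrow> complex mat \<Rightarrow> real" where
  "lp_op_norm p A =
     Sup {lp_norm p (A *\<^sub>v v) | v. v \<in> carrier_vec (dim_col A) \<and> lp_norm p v = 1}"

(* The library has 0 powr 0 = 0; here the convention is 0^0 = 1. *)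
definition rpow :: "real \<Rightarrow> real \<Rightarrow> real" where
  "rpow x a = (if a = 0 then 1 else x powr a)"

(* On ereal, 1 / \<infinity> = 0. *)
definition LA :: "nat \<Rightarrow> complex mat set" where
  "LA n = {A \<in> carrier_mat n n. \<forall>p\<ge>1. lp_op_norm p A =
     rpow (lp_op_norm 1 A) (real_of_ereal (1 / p)) *
     rpow (lp_op_norm \<infinity> A) (1 - real_of_ereal (1 / p))}"

definition cyclic_shift :: "nat \<Rightarrow> complex mat" where
  "cyclic_shift n = mat n n (\<lambda>(i, j). if j = i + 1 \<or> (i = n - 1 \<and> j = 0) then 1 else 0)"

definition circulant :: "nat \<Rightarrow> (nat \<Rightarrow> complex) \<Rightarrow> complex mat" where
  "circulant n \<gamma> =
     finsum (module_mat TYPE(complex) n n) (\<lambda>i. \<gamma> i \<cdot>\<^sub>m (cyclic_shift n ^\<^sub>m i)) {..<n}"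

lemma finsum_module_mat_index:
  fixes f :: "'b \<Rightarrow> complex mat"
  assumes "finite F" and "\<And>k. k \<in> F \<Longrightarrow> f k \<in> carrier_mat n n" and "i < n" and "j < n"
  shows "finsum (module_mat TYPE(complex) n n) f F \<in> carrier_mat n n \<and>
    finsum (module_mat TYPE(complex) n n) f F $$ (i, j) = (\<Sum>k\<in>F. f k $$ (i, j))"
proof -
  interpret M: abelian_group "module_mat TYPE(complex) n n"
    by (rule abelian_group_mat)
  show ?thesis using assms(1,2)
  proof (induction F rule: finite_induct)
    case empty
    then show ?case using M.finsum_empty assms(3,4) by (simp add: module_mat_simps)
  next
    case (insert x F)
    have *: "f \<in> F \<rightarrow> carrier (module_mat TYPE(complex) n n)"
      and **: "f x \<in> carrier (module_mat TYPE(complex) n n)"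
      using insert by (auto simp: module_mat_simps)
    have IH: "finsum (module_mat TYPE(complex) n n) f F \<in> carrier_mat n n \<and>
      finsum (module_mat TYPE(complex) n n) f F $$ (i, j) = (\<Sum>k\<in>F. f k $$ (i, j))"
      using insert by auto
    show ?case
      unfolding M.finsum_insert[OF insert(1,2) * **] module_mat_simps
      using IH insert assms(3,4) by auto
  qed
qed

lemma cyclic_shift_pow_index:
  assumes "i < n" and "j < n"
  shows "(cyclic_shift n ^\<^sub>m k) $$ (i, j) = (if j = (i + k) mod n then 1 else 0)"
  using assms(2)
proof (induction k arbitrary: j)
  case 0
  then show ?case using assms(1) by (auto simp: cyclic_shift_def)
next
  case (Suc k)
  have c: "cyclic_shift n \<in> carrier_mat n n" "cyclic_shift n ^\<^sub>m k \<in> carrier_mat n n"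
    by (auto simp: cyclic_shift_def)
  have S: "cyclic_shift n $$ (l, j) = (if j = Suc l mod n then 1 else 0)" if "l < n" for l
    using that Suc.prems by (auto simp: cyclic_shift_def mod_Suc)
  have "(cyclic_shift n ^\<^sub>m Suc k) $$ (i, j)
      = (\<Sum>l<n. (cyclic_shift n ^\<^sub>m k) $$ (i, l) * cyclic_shift n $$ (l, j))"
    using c assms(1) Suc.prems by (simp add: scalar_prod_def lessThan_atLeast0)
  also have "\<dots> = (\<Sum>l<n. if l = (i + k) mod n then cyclic_shift n $$ (l, j) else 0)"
    by (intro sum.cong refl) (simp add: Suc.IH)
  also have "\<dots> = cyclic_shift n $$ ((i + k) mod n, j)"
    using assms(1) by simp
  also have "\<dots> = (if j = (i + Suc k) mod n then 1 else 0)"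
    using assms(1) by (subst S) (auto simp: mod_Suc_eq)
  finally show ?case .
qed

(* First row (\<gamma> 0, ..., \<gamma> (n - 1)); each further row is the cyclic right shift of the previous one. *)
lemma circulant_index:
  assumes "i < n" and "j < n"
  shows "circulant n \<gamma> $$ (i, j) = \<gamma> ((j + n - i) mod n)"
proof -
  have *: "(j = (i + k) mod n) = (k = (j + n - i) mod n)" if "k < n" for k
    using that assms by (auto simp: mod_if)
  have c: "cyclic_shift n ^\<^sub>m k \<in> carrier_mat n n" for k
    by (auto simp: cyclic_shift_def)
  have "circulant n \<gamma> $$ (i, j) = (\<Sum>k<n. (\<gamma> k \<cdot>\<^sub>m (cyclic_shift n ^\<^sub>m k)) $$ (i, j))"
    unfolding circulant_def using finsum_module_mat_index[of "{..<n}"] assms c by simp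
  also have "\<dots> = (\<Sum>k<n. if k = (j + n - i) mod n then \<gamma> k else 0)"
    using assms carrier_matD[OF c] by (intro sum.cong refl) (simp add: cyclic_shift_pow_index *)
  also have "\<dots> = \<gamma> ((j + n - i) mod n)"
    using assms by simp
  finally show ?thesis .
qed

end

theory Submission
  imports Defs "HOL-Analysis.Convex"
begin

text \<open>
  Write \<open>s\<close> for the sum of the moduli \<open>\<bar>\<alpha> i\<bar>\<close>. Every operator norm of a circulant is at most \<open>s\<close>
  (lemma \<open>lp_norm_circulant_le\<close>), because a power of the shift only permutes coordinates. For
  \<open>p = 1\<close> and \<open>p = \<infinity>\<close> the bound is attained, at a standard basis vector and at a vector whose
  phases cancel those of the first row, respectively. Hence a circulant is logarithmic affine iff
  all its norms are equal to \<open>s\<close>.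

  If the coefficients are \<open>\<beta> * \<omega> ^ i * \<bar>\<alpha> i\<bar>\<close> with \<open>\<omega> ^ n = 1\<close>, then the vector with entries
  \<open>cnj \<omega> ^ i\<close> is an eigenvector for the eigenvalue \<open>\<beta> * s\<close>, so \<open>s\<close> is attained for every \<open>p\<close>.

  Conversely, only \<open>p = 2\<close> is needed. The discrete Fourier transform diagonalises the circulant and
  is an isometry up to a constant factor (\<open>dft_parseval\<close>), so the norm for \<open>p = 2\<close> is at most
  the largest modulus of an eigenvalue (\<open>lp_op_norm_2_circulant_le\<close>). If this norm is \<open>s\<close>, some
  eigenvalue, a sum of terms \<open>\<alpha> i * cnj \<omega> ^ i\<close>, has modulus at least \<open>s\<close>. This is equality in the
  triangle inequality, so all its terms have a common phase \<open>\<beta>\<close>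
  (\<open>common_phase_if_cmod_sum_ge\<close>), which is the claimed form of the coefficients.
\<close>

section \<open>Two inequalities for finite sums\<close>

text \<open>
  Jensen's inequality for the convex function \<open>x \<mapsto> x powr p\<close>. The terms with \<open>y i = 0\<close> are
  discarded first, so that convexity is used only on the positive reals; the remaining
  total weight can only be smaller.
\<close>

lemma powr_weighted_sum_le:
  fixes a y :: "'i \<Rightarrow> real"
  assumes "finite I" and p: "p \<ge> 1"
    and a: "\<And>i. i \<in> I \<Longrightarrow> a i \<ge> 0" and y: "\<And>i. i \<in> I \<Longrightarrow> y i \<ge> 0"
  shows "(\<Sum>i\<in>I. a i * y i) powr p \<le> (\<Sum>i\<in>I. a i) powr (p - 1) * (\<Sum>i\<in>I. a i * y i powr p)"
proof -
  define T where "T = {i\<in>I. y i > 0}"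
  define t where "t = (\<Sum>i\<in>T. a i)"
  have T: "finite T" "T \<subseteq> I"
    using assms(1) by (auto simp: T_def)
  have zero: "y i = 0" if "i \<in> I - T" for i
    using that y[of i] by (auto simp: T_def)
  have sum1: "(\<Sum>i\<in>I. a i * y i) = (\<Sum>i\<in>T. a i * y i)"
    using T zero assms(1) by (intro sum.mono_neutral_right) auto
  have sum2: "(\<Sum>i\<in>I. a i * y i powr p) = (\<Sum>i\<in>T. a i * y i powr p)"
    using T zero assms(1) by (intro sum.mono_neutral_right) auto
  have nonneg: "(\<Sum>i\<in>T. a i * y i powr p) \<ge> 0"
    using T a by (intro sum_nonneg) auto
  have t0: "t \<ge> 0"
    using T a unfolding t_def by (intro sum_nonneg) auto
  have "(\<Sum>i\<in>T. a i * y i) powr p \<le> t powr (p - 1) * (\<Sum>i\<in>T. a i * y i powr p)"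
  proof (cases "t = 0")
    case True
    have "a i = 0" if "i \<in> T" for i
      using True that T a sum_nonneg_eq_0_iff[of T a] by (auto simp: t_def)
    then show ?thesis by simp
  next
    case False
    then have tp: "t > 0" using t0 by simp
    then have "T \<noteq> {}" by (auto simp: t_def)
    have "(\<Sum>i\<in>T. (a i / t) *\<^sub>R y i) powr p \<le> (\<Sum>i\<in>T. a i / t * y i powr p)"
    proof (rule convex_on_sum[OF T(1) \<open>T \<noteq> {}\<close> powr_convex[OF p]])
      show "(\<Sum>i\<in>T. a i / t) = 1"
        using tp by (simp flip: sum_divide_distrib add: t_def)
    qed (use tp T a in \<open>auto simp: T_def\<close>)
    then have "((\<Sum>i\<in>T. a i * y i) / t) powr p \<le> (\<Sum>i\<in>T. a i * y i powr p) / t"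
      by (simp add: sum_divide_distrib)
    moreover have "((\<Sum>i\<in>T. a i * y i) / t) powr p = (\<Sum>i\<in>T. a i * y i) powr p / t powr p"
      by (rule powr_divide)
    ultimately have "(\<Sum>i\<in>T. a i * y i) powr p \<le> t powr p / t * (\<Sum>i\<in>T. a i * y i powr p)"
      using tp by (simp add: field_simps)
    also have "t powr p / t = t powr (p - 1)"
      using tp by (simp add: powr_diff)
    finally show ?thesis .
  qed
  also have "\<dots> \<le> (\<Sum>i\<in>I. a i) powr (p - 1) * (\<Sum>i\<in>T. a i * y i powr p)"
  proof (intro mult_right_mono powr_mono2 nonneg)
    show "t \<le> (\<Sum>i\<in>I. a i)"
      unfolding t_def using T a assms(1) by (intro sum_mono2) auto
  qed (use p t0 in auto)
  finally show ?thesis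
    by (simp add: sum1 sum2)
qed

text \<open>
  The equality case of the triangle inequality. If \<open>\<beta>\<close> is the phase of the sum, then the real
  parts of \<open>cnj \<beta> * f i\<close> add up to the modulus of the sum, so none of them can be smaller than
  the modulus of \<open>f i\<close>.
\<close>

lemma common_phase_if_cmod_sum_ge:
  fixes f :: "'i \<Rightarrow> complex"
  assumes I: "finite I" and ge: "(\<Sum>i\<in>I. cmod (f i)) \<le> cmod (\<Sum>i\<in>I. f i)"
  obtains \<beta> where "cmod \<beta> = 1" and "\<And>i. i \<in> I \<Longrightarrow> f i = \<beta> * complex_of_real (cmod (f i))"
proof (cases "(\<Sum>i\<in>I. f i) = 0")
  case True
  then have "(\<Sum>i\<in>I. cmod (f i)) = 0"
    using ge by (intro antisym sum_nonneg) auto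
  then have "f i = 0" if "i \<in> I" for i
    using that I by (simp add: sum_nonneg_eq_0_iff)
  then show thesis by (intro that[of 1]) auto
next
  case False
  define \<beta> where "\<beta> = sgn (\<Sum>i\<in>I. f i)"
  have \<beta>: "cmod \<beta> = 1"
    using False by (simp add: \<beta>_def norm_sgn)
  have \<beta>cnj: "\<beta> * cnj \<beta> = 1"
    using \<beta> by (simp add: complex_norm_square[symmetric])
  have "(\<Sum>i\<in>I. f i) = \<beta> * cmod (\<Sum>i\<in>I. f i)"
    using False by (simp add: \<beta>_def sgn_eq)
  then have "cnj \<beta> * (\<Sum>i\<in>I. f i) = cmod (\<Sum>i\<in>I. f i)"
    using \<beta>cnj by (metis mult.assoc mult.commute mult.left_neutral)
  then have "(\<Sum>i\<in>I. Re (cnj \<beta> * f i)) = cmod (\<Sum>i\<in>I. f i)"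
    by (metis Re_complex_of_real Re_sum sum_distrib_left)
  moreover have le: "Re (cnj \<beta> * f i) \<le> cmod (f i)" for i
    using complex_Re_le_cmod[of "cnj \<beta> * f i"] \<beta> by (simp add: norm_mult)
  moreover have "(\<Sum>i\<in>I. Re (cnj \<beta> * f i)) \<le> (\<Sum>i\<in>I. cmod (f i))"
    by (intro sum_mono le)
  ultimately have "(\<Sum>i\<in>I. Re (cnj \<beta> * f i)) = (\<Sum>i\<in>I. cmod (f i))"
    using ge by linarith
  then have Re_eq: "Re (cnj \<beta> * f i) = cmod (f i)" if "i \<in> I" for i
    using sum_mono_inv[of "\<lambda>i. Re (cnj \<beta> * f i)" I "\<lambda>i. cmod (f i)"] le that I by blast
  have "f i = \<beta> * complex_of_real (cmod (f i))" if "i \<in> I" for i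
  proof -
    have "cmod (cnj \<beta> * f i) = Re (cnj \<beta> * f i)"
      using Re_eq[OF that] \<beta> by (simp add: norm_mult)
    then have "Im (cnj \<beta> * f i) = 0"
      by (metis abs_ge_zero cmod_eq_Re norm_ge_zero cmod_Re_le_iff abs_of_nonneg cmod_power2
          power2_eq_square add_cancel_left_right mult_eq_0_iff)
    then have "cnj \<beta> * f i = complex_of_real (cmod (f i))"
      using Re_eq[OF that] by (simp add: complex_eq_iff)
    then show ?thesis
      using \<beta>cnj by (metis mult.assoc mult.left_neutral)
  qed
  with \<beta> show thesis by (rule that)
qed

section \<open>The operator norm from a bound and a test vector\<close>

lemma lp_norm_nonneg:
  assumes "dim_vec v > 0"
  shows "lp_norm p v \<ge> 0"
proof (cases "p = \<infinity>")
  case True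
  have "0 \<le> cmod (v $ 0)" by simp
  also have "\<dots> \<le> Max ((\<lambda>i. cmod (v $ i)) ` {..<dim_vec v})"
    using assms by (intro Max_ge) auto
  finally show ?thesis using True by (simp add: lp_norm_def)
qed (simp add: lp_norm_def)

lemma lp_norm_smult:
  assumes "dim_vec v > 0" and "p \<ge> 1"
  shows "lp_norm p (c \<cdot>\<^sub>v v) = cmod c * lp_norm p v"
proof (cases p)
  case (real r)
  then have r: "r \<ge> 1" using assms(2) by simp
  have "(\<Sum>i<dim_vec v. cmod ((c \<cdot>\<^sub>v v) $ i) powr r)
      = cmod c powr r * (\<Sum>i<dim_vec v. cmod (v $ i) powr r)"
    by (simp add: norm_mult powr_mult sum_distrib_left)
  then show ?thesis
    using r real by (simp add: lp_norm_def powr_mult sum_nonneg powr_powr)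
next
  case PInf
  have "Max ((\<lambda>i. cmod ((c \<cdot>\<^sub>v v) $ i)) ` {..<dim_vec v})
      = Max ((\<lambda>x. cmod c * x) ` (\<lambda>i. cmod (v $ i)) ` {..<dim_vec v})"
    unfolding image_image by (intro arg_cong[of _ _ Max] image_cong) (auto simp: norm_mult)
  also have "\<dots> = cmod c * Max ((\<lambda>i. cmod (v $ i)) ` {..<dim_vec v})"
    using assms(1)
    by (intro mono_Max_commute[symmetric]) (auto simp: mono_def intro!: mult_left_mono)
  finally show ?thesis using PInf by (simp add: lp_norm_def)
qed (use assms in simp)

lemma lp_norm_pos:
  assumes "i < dim_vec v" and "v $ i \<noteq> 0" and "p \<ge> 1"
  shows "lp_norm p v > 0"
proof (cases p)
  case (real r)
  have "0 < cmod (v $ i) powr r" using assms by simp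
  also have "\<dots> \<le> (\<Sum>i<dim_vec v. cmod (v $ i) powr r)"
    using assms by (intro member_le_sum) auto
  finally show ?thesis using real by (simp add: lp_norm_def)
next
  case PInf
  have "0 < cmod (v $ i)" using assms by simp
  also have "\<dots> \<le> Max ((\<lambda>i. cmod (v $ i)) ` {..<dim_vec v})"
    using assms by (intro Max_ge) auto
  finally show ?thesis using PInf by (simp add: lp_norm_def)
qed (use assms in simp)

lemma lp_norm_normalize:
  assumes "A \<in> carrier_mat n n" and "n > 0" and "p \<ge> 1"
    and "u \<in> carrier_vec n" and "lp_norm p u > 0"
  obtains v where "v \<in> carrier_vec n" "lp_norm p v = 1"
    "lp_norm p (A *\<^sub>v v) = lp_norm p (A *\<^sub>v u) / lp_norm p u"
proof
  let ?c = "complex_of_real (1 / lp_norm p u)"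
  show "?c \<cdot>\<^sub>v u \<in> carrier_vec n" using assms by simp
  show "lp_norm p (?c \<cdot>\<^sub>v u) = 1"
    using assms by (subst lp_norm_smult) (auto simp: norm_divide)
  have "A *\<^sub>v (?c \<cdot>\<^sub>v u) = ?c \<cdot>\<^sub>v (A *\<^sub>v u)"
    using assms by (intro mult_mat_vec)
  then show "lp_norm p (A *\<^sub>v (?c \<cdot>\<^sub>v u)) = lp_norm p (A *\<^sub>v u) / lp_norm p u"
    using assms by (simp add: lp_norm_smult norm_divide)
qed

lemma lp_op_norm_le:
  assumes "A \<in> carrier_mat n n" and "n > 0" and "p \<ge> 1"
    and "\<And>v. v \<in> carrier_vec n \<Longrightarrow> lp_norm p (A *\<^sub>v v) \<le> s * lp_norm p v"
  shows "lp_op_norm p A \<le> s"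
proof -
  have "lp_norm p (unit_vec n 0) > 0"
    using assms by (intro lp_norm_pos[of 0]) auto
  then obtain v where "v \<in> carrier_vec n" "lp_norm p v = 1"
    using lp_norm_normalize[of A n p "unit_vec n 0"] assms by auto
  \<comment> \<open>The set of norms has to be nonempty: the supremum of the empty set is unspecified.\<close>
  then show ?thesis
    unfolding lp_op_norm_def using assms(1) by (intro cSup_least) (blast, auto dest!: assms(4))
qed

lemma lp_op_norm_eqI:
  assumes "A \<in> carrier_mat n n" and "n > 0" and "p \<ge> 1"
    and bound: "\<And>v. v \<in> carrier_vec n \<Longrightarrow> lp_norm p (A *\<^sub>v v) \<le> s * lp_norm p v"
    and u: "u \<in> carrier_vec n" "lp_norm p u > 0" "s * lp_norm p u \<le> lp_norm p (A *\<^sub>v u)"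
  shows "lp_op_norm p A = s"
proof (rule antisym)
  show "lp_op_norm p A \<le> s" using assms by (intro lp_op_norm_le)
  obtain v where v: "v \<in> carrier_vec n" "lp_norm p v = 1"
    "lp_norm p (A *\<^sub>v v) = lp_norm p (A *\<^sub>v u) / lp_norm p u"
    using lp_norm_normalize[OF assms(1-3) u(1,2)] by blast
  have "s \<le> lp_norm p (A *\<^sub>v v)"
    using u by (simp add: v(3) field_simps)
  also have "\<dots> \<le> lp_op_norm p A"
    unfolding lp_op_norm_def
  proof (rule cSup_upper)
    show "bdd_above {lp_norm p (A *\<^sub>v v) |v. v \<in> carrier_vec (dim_col A) \<and> lp_norm p v = 1}"
      using assms(1) by (intro bdd_aboveI[of _ s]) (auto dest!: bound)
    show "lp_norm p (A *\<^sub>v v) \<in> {lp_norm p (A *\<^sub>v v) |v. v \<in> carrier_vec (dim_col A) \<and> lp_norm p v = 1}"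
      unfolding carrier_matD(2)[OF assms(1)] using v(1,2) by blast
  qed
  finally show "s \<le> lp_op_norm p A" .
qed

section \<open>Norm bounds for circulants\<close>

lemma sum_cyclic_shift:
  fixes f :: "nat \<Rightarrow> 'b::comm_monoid_add"
  assumes "n > 0"
  shows "(\<Sum>i<n. f ((i + k) mod n)) = (\<Sum>i<n. f i)"
proof -
  have inj: "inj_on (\<lambda>i. (i + k) mod n) {..<n}"
  proof (rule inj_onI)
    fix i j assume "i \<in> {..<n}" "j \<in> {..<n}" "(i + k) mod n = (j + k) mod n"
    moreover obtain k' where "k' = k mod n" "k' < n"
      using assms by simp
    ultimately have "(i + k') mod n = (j + k') mod n" "i < n" "j < n" "k' < n"
      by (simp_all add: mod_add_right_eq)
    then show "i = j"
      by (auto simp: mod_if split: if_splits)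
  qed
  have "(\<lambda>i. (i + k) mod n) ` {..<n} = {..<n}"
    using assms by (intro endo_inj_surj inj) auto
  then have "bij_betw (\<lambda>i. (i + k) mod n) {..<n} {..<n}"
    using inj by (simp add: bij_betw_def)
  then show ?thesis by (rule sum.reindex_bij_betw)
qed

lemma circulant_carrier [simp]: "n > 0 \<Longrightarrow> circulant n \<alpha> \<in> carrier_mat n n"
  using finsum_module_mat_index[of "{..<n}" "\<lambda>i. \<alpha> i \<cdot>\<^sub>m (cyclic_shift n ^\<^sub>m i)" n 0 0]
  by (auto simp: circulant_def cyclic_shift_def)

lemma circulant_mult_vec_index:
  assumes "v \<in> carrier_vec n" and "i < n"
  shows "(circulant n \<alpha> *\<^sub>v v) $ i = (\<Sum>k<n. \<alpha> k * v $ ((i + k) mod n))"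
proof -
  have n: "n > 0" using assms by simp
  have c: "dim_row (circulant n \<alpha>) = n" "dim_col (circulant n \<alpha>) = n"
    using circulant_carrier[OF n] by auto
  have "(circulant n \<alpha> *\<^sub>v v) $ i = (\<Sum>j<n. \<alpha> ((j + n - i) mod n) * v $ j)"
    using assms c by (simp add: scalar_prod_def lessThan_atLeast0 circulant_index)
  also have "\<dots> = (\<Sum>k<n. \<alpha> (((k + i) mod n + n - i) mod n) * v $ ((k + i) mod n))"
    by (rule sum_cyclic_shift[OF n, symmetric])
  also have "\<dots> = (\<Sum>k<n. \<alpha> k * v $ ((i + k) mod n))"
  proof (intro sum.cong refl)
    fix k assume "k \<in> {..<n}"
    then have "((k + i) mod n + n - i) mod n = k"
      using assms by (auto simp: mod_if)
    then show "\<alpha> (((k + i) mod n + n - i) mod n) * v $ ((k + i) mod n) = \<alpha> k * v $ ((i + k) mod n)"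
      by (simp add: add.commute)
  qed
  finally show ?thesis .
qed

text \<open>
  For finite \<open>p\<close>, Jensen's inequality bounds each entry of the product by a weighted mean of
  the \<open>p\<close>-th powers; summed over the entries, each weight multiplies the same sum up to a
  cyclic reindexing.
\<close>

lemma lp_norm_circulant_le:
  assumes v: "v \<in> carrier_vec n" and n: "n > 0" and p: "p \<ge> 1"
  shows "lp_norm p (circulant n \<alpha> *\<^sub>v v) \<le> (\<Sum>i<n. cmod (\<alpha> i)) * lp_norm p v"
proof -
  let ?w = "circulant n \<alpha> *\<^sub>v v" and ?s = "\<Sum>i<n. cmod (\<alpha> i)"
  have dim: "dim_vec ?w = n" "dim_vec v = n"
    using circulant_carrier[OF n] v by auto
  have entry: "cmod (?w $ i) \<le> (\<Sum>k<n. cmod (\<alpha> k) * cmod (v $ ((i + k) mod n)))" if "i < n" for i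
    using sum_norm_le[of "{..<n}" "\<lambda>k. \<alpha> k * v $ ((i + k) mod n)"]
    by (simp add: circulant_mult_vec_index[OF v that] norm_mult)
  show ?thesis
  proof (cases p)
    case (real r)
    then have r: "r \<ge> 1" using p by simp
    have s: "?s \<ge> 0" by (intro sum_nonneg) auto
    have "(\<Sum>i<n. cmod (?w $ i) powr r)
        \<le> (\<Sum>i<n. (\<Sum>k<n. cmod (\<alpha> k) * cmod (v $ ((i + k) mod n))) powr r)"
      using entry r by (intro sum_mono powr_mono2) auto
    also have "\<dots> \<le> (\<Sum>i<n. ?s powr (r - 1) * (\<Sum>k<n. cmod (\<alpha> k) * cmod (v $ ((i + k) mod n)) powr r))"
      using r by (intro sum_mono powr_weighted_sum_le) auto
    also have "\<dots> = ?s powr (r - 1) * (\<Sum>k<n. cmod (\<alpha> k) * (\<Sum>i<n. cmod (v $ ((i + k) mod n)) powr r))"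
      by (subst sum_distrib_left[symmetric], subst sum.swap) (simp add: sum_distrib_left)
    also have "\<dots> = ?s powr (r - 1) * ?s * (\<Sum>i<n. cmod (v $ i) powr r)"
      by (simp add: sum_cyclic_shift[OF n, where f = "\<lambda>i. cmod (v $ i) powr r"] sum_distrib_right)
    also have "?s powr (r - 1) * ?s = ?s powr r"
      using s by (cases "?s = 0") (auto simp: powr_diff)
    finally have "(\<Sum>i<n. cmod (?w $ i) powr r) powr (1 / r)
        \<le> (?s powr r * (\<Sum>i<n. cmod (v $ i) powr r)) powr (1 / r)"
      using r by (intro powr_mono2 sum_nonneg) auto
    also have "\<dots> = ?s * (\<Sum>i<n. cmod (v $ i) powr r) powr (1 / r)"
      using r s by (simp add: powr_mult sum_nonneg powr_powr)
    finally show ?thesis using real dim by (simp add: lp_norm_def)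
  next
    case PInf
    let ?m = "Max ((\<lambda>i. cmod (v $ i)) ` {..<n})"
    have "cmod (?w $ i) \<le> ?s * ?m" if "i < n" for i
    proof -
      have "(\<Sum>k<n. cmod (\<alpha> k) * cmod (v $ ((i + k) mod n))) \<le> (\<Sum>k<n. cmod (\<alpha> k) * ?m)"
        using n by (intro sum_mono mult_left_mono Max_ge) auto
      then show ?thesis
        using entry[OF that] by (simp add: sum_distrib_right)
    qed
    then have "Max ((\<lambda>i. cmod (?w $ i)) ` {..<n}) \<le> ?s * ?m"
      using n by (intro Max.boundedI) auto
    then show ?thesis using PInf dim by (simp add: lp_norm_def)
  qed (use p in simp)
qed

lemma lp_op_norm_1_circulant:
  assumes n: "n > 0"
  shows "lp_op_norm 1 (circulant n \<alpha>) = (\<Sum>i<n. cmod (\<alpha> i))"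
proof (rule lp_op_norm_eqI[OF circulant_carrier[OF n] n])
  let ?u = "unit_vec n 0 :: complex vec" and ?A = "circulant n \<alpha>"
  have norm1: "lp_norm 1 w = (\<Sum>i<dim_vec w. cmod (w $ i))" for w
    by (simp add: lp_norm_def one_ereal_def sum_nonneg)
  have "(\<Sum>i<n. cmod (?u $ i)) = (\<Sum>i<n. if i = 0 then 1 else 0)"
    by (intro sum.cong) auto
  then have u: "lp_norm 1 ?u = 1"
    using n by (simp add: norm1)
  then show "lp_norm 1 ?u > 0" by simp
  have "cmod ((?A *\<^sub>v ?u) $ i) = cmod (\<alpha> ((n - i) mod n))" if "i < n" for i
    using that carrier_matD[OF circulant_carrier[OF n]] n by (simp add: circulant_index)
  then have "lp_norm 1 (?A *\<^sub>v ?u) = (\<Sum>i<n. cmod (\<alpha> ((n - i) mod n)))"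
    using carrier_matD[OF circulant_carrier[OF n]] by (simp add: norm1)
  also have "\<dots> = (\<Sum>i<n. cmod (\<alpha> i))"
    by (rule sum.reindex_bij_witness[of _ "\<lambda>i. (n - i) mod n" "\<lambda>i. (n - i) mod n"])
       (use n in \<open>auto simp: mod_if\<close>)
  finally show "(\<Sum>i<n. cmod (\<alpha> i)) * lp_norm 1 ?u \<le> lp_norm 1 (?A *\<^sub>v ?u)"
    using u by simp
qed (use n lp_norm_circulant_le in auto)

lemma lp_op_norm_infinity_circulant:
  assumes n: "n > 0"
  shows "lp_op_norm \<infinity> (circulant n \<alpha>) = (\<Sum>i<n. cmod (\<alpha> i))"
proof (rule lp_op_norm_eqI[OF circulant_carrier[OF n] n])
  \<comment> \<open>The zero coefficients get phase 1, so that the test vector is nonzero even if all vanish.\<close>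
  define u where "u = vec n (\<lambda>k. if \<alpha> k = 0 then 1 else cnj (sgn (\<alpha> k)))"
  let ?A = "circulant n \<alpha>"
  show uc: "u \<in> carrier_vec n" by (simp add: u_def)
  have "cmod (u $ k) = 1" if "k < n" for k
    using that by (simp add: u_def norm_sgn)
  then have "(\<lambda>i. cmod (u $ i)) ` {..<n} = {1}"
    using n by (auto simp: image_iff intro!: exI[of _ 0])
  then have u: "lp_norm \<infinity> u = 1"
    using uc by (simp add: lp_norm_def)
  then show "lp_norm \<infinity> u > 0" by simp
  have phase: "\<alpha> k * u $ k = complex_of_real (cmod (\<alpha> k))" if "k < n" for k
  proof (cases "\<alpha> k = 0")
    case False
    then have "\<alpha> k * u $ k = \<alpha> k * cnj (\<alpha> k) / cmod (\<alpha> k)"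
      using that by (simp add: u_def sgn_eq)
    also have "\<dots> = complex_of_real (cmod (\<alpha> k))"
      using False by (simp add: complex_norm_square[symmetric] power2_eq_square)
    finally show ?thesis .
  qed (use that in \<open>simp add: u_def\<close>)
  have "(?A *\<^sub>v u) $ 0 = (\<Sum>k<n. \<alpha> k * u $ k)"
    using circulant_mult_vec_index[OF uc n, of \<alpha>] by simp
  also have "\<dots> = complex_of_real (\<Sum>k<n. cmod (\<alpha> k))"
    by (simp add: phase)
  finally have "cmod ((?A *\<^sub>v u) $ 0) = (\<Sum>k<n. cmod (\<alpha> k))"
    by (simp only: norm_of_real abs_of_nonneg sum_nonneg norm_ge_zero)
  moreover have "cmod ((?A *\<^sub>v u) $ 0) \<le> lp_norm \<infinity> (?A *\<^sub>v u)"
    using n carrier_matD[OF circulant_carrier[OF n]] by (auto simp: lp_norm_def intro!: Max_ge)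
  ultimately show "(\<Sum>i<n. cmod (\<alpha> i)) * lp_norm \<infinity> u \<le> lp_norm \<infinity> (?A *\<^sub>v u)"
    using u by simp
qed (use n lp_norm_circulant_le in auto)

lemma circulant_in_LA_iff:
  assumes n: "n > 0"
  shows "circulant n \<alpha> \<in> LA n \<longleftrightarrow> (\<forall>p\<ge>1. lp_op_norm p (circulant n \<alpha>) = (\<Sum>i<n. cmod (\<alpha> i)))"
proof -
  let ?s = "\<Sum>i<n. cmod (\<alpha> i)"
  have "?s \<ge> 0" by (intro sum_nonneg) auto
  then have "rpow ?s a * rpow ?s (1 - a) = ?s" for a
    by (cases "?s = 0") (auto simp: rpow_def simp flip: powr_add)
  then show ?thesis
    using n by (simp add: LA_def lp_op_norm_1_circulant lp_op_norm_infinity_circulant)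
qed

section \<open>The case p = 2 by the discrete Fourier transform\<close>

text \<open>
  The value at \<open>\<zeta> ^ k\<close> of the polynomial with coefficients \<open>f\<close>. For a primitive \<open>n\<close>-th root of
  unity \<open>\<zeta>\<close> and \<open>k < n\<close> this is the discrete Fourier transform of \<open>f\<close>, indexed by \<open>k\<close>.
\<close>

definition dft :: "complex \<Rightarrow> nat \<Rightarrow> (nat \<Rightarrow> complex) \<Rightarrow> nat \<Rightarrow> complex" where
  "dft \<zeta> n f k = (\<Sum>j<n. f j * (\<zeta> ^ k) ^ j)"

lemma primitive_root_of_unity:
  assumes "n > 0"
  obtains \<zeta> :: complex where "\<zeta> ^ n = 1" and "inj_on (\<lambda>k. \<zeta> ^ k) {..<n}"
proof
  show "cis (2 * pi / n) ^ n = 1"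
    using assms by (simp add: DeMoivre)
  have "(\<lambda>k. cis (2 * pi / n) ^ k) = (\<lambda>k. cis (2 * pi * real k / real n))"
    by (simp add: DeMoivre mult_ac)
  then show "inj_on (\<lambda>k. cis (2 * pi / n) ^ k) {..<n}"
    using bij_betw_roots_unity[OF assms] by (simp add: bij_betw_def)
qed

lemma root_of_unity_mult_cnj:
  fixes z :: complex
  assumes "z ^ n = 1" and "n > 0"
  shows "z * cnj z = 1"
  using power_eq_1_iff[OF assms(1)] assms(2) by (simp add: complex_norm_square[symmetric])

lemma power_mod_root_of_unity:
  fixes z :: "'a::monoid_mult"
  assumes "z ^ n = 1"
  shows "z ^ (m mod n) = z ^ m"
proof -
  have "z ^ m = z ^ (n * (m div n) + m mod n)" by simp
  also have "\<dots> = z ^ (m mod n)"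
    using assms by (simp only: power_add power_mult power_one mult_1_left)
  finally show ?thesis by simp
qed

text \<open>
  Parseval's identity, from the orthogonality of the characters: for \<open>j \<noteq> l\<close> the number
  \<open>\<zeta> ^ j * cnj (\<zeta> ^ l)\<close> is a root of unity different from 1, so its powers sum to 0.
\<close>

lemma dft_parseval:
  assumes n: "n > 0" and \<zeta>: "\<zeta> ^ n = 1" "inj_on (\<lambda>k. \<zeta> ^ k) {..<n}"
  shows "(\<Sum>k<n. (cmod (dft \<zeta> n f k))\<^sup>2) = n * (\<Sum>j<n. (cmod (f j))\<^sup>2)"
proof -
  have unit: "\<zeta> * cnj \<zeta> = 1" using root_of_unity_mult_cnj[OF \<zeta>(1) n] .
  have unit_pow: "\<zeta> ^ l * cnj (\<zeta> ^ l) = 1" for l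
    using unit by (simp flip: power_mult_distrib)
  have orth: "(\<Sum>k<n. (\<zeta> ^ j * cnj (\<zeta> ^ l)) ^ k) = (if j = l then of_nat n else 0)"
    if jl: "j < n" "l < n" for j l
  proof (cases "j = l")
    case True
    then show ?thesis using unit_pow[of l] by simp
  next
    case False
    let ?w = "\<zeta> ^ j * cnj (\<zeta> ^ l)"
    have "?w \<noteq> 1"
    proof
      assume "?w = 1"
      then have "\<zeta> ^ j = \<zeta> ^ l"
        using unit_pow[of l] by (metis mult.assoc mult.commute mult.right_neutral)
      with False jl \<zeta>(2) show False by (auto dest: inj_onD)
    qed
    moreover have "?w ^ n = 1"
    proof -
      have "?w ^ n = (\<zeta> ^ n) ^ j * cnj ((\<zeta> ^ n) ^ l)"
        by (simp add: power_mult_distrib mult.commute flip: power_mult)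
      then show ?thesis using \<zeta>(1) by simp
    qed
    ultimately show ?thesis
      using False by (simp add: geometric_sum del: complex_cnj_power)
  qed
  have "complex_of_real (\<Sum>k<n. (cmod (dft \<zeta> n f k))\<^sup>2)
      = (\<Sum>k<n. \<Sum>j<n. \<Sum>l<n. f j * cnj (f l) * (\<zeta> ^ j * cnj (\<zeta> ^ l)) ^ k)"
    by (simp add: complex_norm_square dft_def sum_product power_mult_distrib mult_ac
        flip: power_mult del: of_real_power)
  also have "\<dots> = (\<Sum>j<n. \<Sum>k<n. \<Sum>l<n. f j * cnj (f l) * (\<zeta> ^ j * cnj (\<zeta> ^ l)) ^ k)"
    by (rule sum.swap)
  also have "\<dots> = (\<Sum>j<n. \<Sum>l<n. f j * cnj (f l) * (\<Sum>k<n. (\<zeta> ^ j * cnj (\<zeta> ^ l)) ^ k))"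
    unfolding sum_distrib_left by (rule sum.cong, rule refl, rule sum.swap)
  also have "\<dots> = (\<Sum>j<n. \<Sum>l<n. if j = l then f j * cnj (f l) * of_nat n else 0)"
    by (intro sum.cong refl) (simp add: orth del: complex_cnj_power)
  also have "\<dots> = complex_of_real (n * (\<Sum>j<n. (cmod (f j))\<^sup>2))"
    by (simp add: complex_norm_square sum_distrib_left mult_ac del: of_real_power)
  finally show ?thesis by (simp only: of_real_eq_iff)
qed

text \<open>
  A shift of the entries multiplies the transform by a power of \<open>cnj (\<zeta> ^ k)\<close>, so a circulant
  acts on it as multiplication by its eigenvalues.
\<close>

lemma dft_circulant:
  assumes n: "n > 0" and \<zeta>: "\<zeta> ^ n = 1" and v: "v \<in> carrier_vec n"
  shows "dft \<zeta> n (\<lambda>i. (circulant n \<alpha> *\<^sub>v v) $ i) k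
    = (\<Sum>m<n. \<alpha> m * cnj (\<zeta> ^ k) ^ m) * dft \<zeta> n (\<lambda>i. v $ i) k"
proof -
  define z where "z = \<zeta> ^ k"
  have z: "z ^ n = 1"
    using \<zeta> by (metis z_def power_mult mult.commute power_one)
  have unit_pow: "cnj z ^ m * z ^ m = 1" for m
    using root_of_unity_mult_cnj[OF z n] by (simp add: mult.commute flip: power_mult_distrib)
  have step: "\<alpha> m * v $ ((i + m) mod n) * z ^ i
      = \<alpha> m * cnj z ^ m * (v $ ((i + m) mod n) * z ^ ((i + m) mod n))" for m i
  proof -
    have "z ^ i = cnj z ^ m * z ^ ((i + m) mod n)"
      using unit_pow[of m] by (simp add: power_mod_root_of_unity[OF z] power_add)
    then show ?thesis by simp
  qed
  have "dft \<zeta> n (\<lambda>i. (circulant n \<alpha> *\<^sub>v v) $ i) k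
      = (\<Sum>i<n. \<Sum>m<n. \<alpha> m * v $ ((i + m) mod n) * z ^ i)"
    by (simp add: dft_def z_def circulant_mult_vec_index[OF v] sum_distrib_right)
  also have "\<dots> = (\<Sum>m<n. \<alpha> m * cnj z ^ m * (\<Sum>i<n. v $ ((i + m) mod n) * z ^ ((i + m) mod n)))"
    unfolding step sum_distrib_left by (rule sum.swap)
  also have "\<dots> = (\<Sum>m<n. \<alpha> m * cnj z ^ m) * dft \<zeta> n (\<lambda>i. v $ i) k"
    using sum_cyclic_shift[OF n, where f = "\<lambda>i. v $ i * z ^ i"]
    by (simp add: dft_def z_def sum_distrib_right)
  finally show ?thesis by (simp add: z_def)
qed

lemma lp_norm_2: "lp_norm 2 v = sqrt (\<Sum>i<dim_vec v. (cmod (v $ i))\<^sup>2)"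
proof -
  have "lp_norm 2 v = (\<Sum>i<dim_vec v. (cmod (v $ i))\<^sup>2) powr (1 / 2)"
    by (simp add: lp_norm_def)
  also have "\<dots> = sqrt (\<Sum>i<dim_vec v. (cmod (v $ i))\<^sup>2)"
    by (intro powr_half_sqrt sum_nonneg) auto
  finally show ?thesis .
qed

text \<open>
  The root \<open>\<omega>\<close> is chosen to maximise the modulus of the eigenvalue; each component of the
  transform grows by at most that factor, and Parseval's identity carries this back to the vector.
\<close>

lemma lp_op_norm_2_circulant_le:
  assumes n: "n > 0"
  obtains \<omega> where "\<omega> ^ n = 1"
    and "lp_op_norm 2 (circulant n \<alpha>) \<le> cmod (\<Sum>i<n. \<alpha> i * cnj \<omega> ^ i)"
proof -
  obtain \<zeta> :: complex where \<zeta>: "\<zeta> ^ n = 1" "inj_on (\<lambda>k. \<zeta> ^ k) {..<n}"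
    using primitive_root_of_unity[OF n] .
  define ev where "ev k = cmod (\<Sum>i<n. \<alpha> i * cnj (\<zeta> ^ k) ^ i)" for k
  define M where "M = Max (ev ` {..<n})"
  have "M \<in> ev ` {..<n}"
    unfolding M_def using n by (intro Max_in) auto
  then obtain k where k: "M = ev k" by auto
  have M: "ev j \<le> M" if "j < n" for j
    unfolding M_def using that by (intro Max_ge) auto
  have M0: "M \<ge> 0" by (simp add: k ev_def)
  have "lp_op_norm 2 (circulant n \<alpha>) \<le> M"
  proof (rule lp_op_norm_le[OF circulant_carrier[OF n] n])
    fix v :: "complex vec" assume v: "v \<in> carrier_vec n"
    let ?w = "circulant n \<alpha> *\<^sub>v v"
    have "n * (\<Sum>j<n. (cmod (?w $ j))\<^sup>2) = (\<Sum>j<n. (cmod (dft \<zeta> n (\<lambda>i. ?w $ i) j))\<^sup>2)"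
      by (rule dft_parseval[OF n \<zeta>, symmetric])
    also have "\<dots> = (\<Sum>j<n. (ev j)\<^sup>2 * (cmod (dft \<zeta> n (\<lambda>i. v $ i) j))\<^sup>2)"
      by (simp add: dft_circulant[OF n \<zeta>(1) v] norm_mult power_mult_distrib ev_def
          del: complex_cnj_power)
    also have "\<dots> \<le> (\<Sum>j<n. M\<^sup>2 * (cmod (dft \<zeta> n (\<lambda>i. v $ i) j))\<^sup>2)"
      using M by (intro sum_mono mult_right_mono power_mono) (auto simp: ev_def)
    also have "\<dots> = n * (M\<^sup>2 * (\<Sum>j<n. (cmod (v $ j))\<^sup>2))"
      using dft_parseval[OF n \<zeta>, of "\<lambda>i. v $ i"] by (simp flip: sum_distrib_left)
    finally have "(\<Sum>j<n. (cmod (?w $ j))\<^sup>2) \<le> M\<^sup>2 * (\<Sum>j<n. (cmod (v $ j))\<^sup>2)"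
      using n by simp
    then have "sqrt (\<Sum>j<n. (cmod (?w $ j))\<^sup>2) \<le> M * sqrt (\<Sum>j<n. (cmod (v $ j))\<^sup>2)"
      using M0 by (metis real_sqrt_le_mono real_sqrt_mult real_sqrt_unique)
    then show "lp_norm 2 ?w \<le> M * lp_norm 2 v"
      unfolding lp_norm_2 using v carrier_matD[OF circulant_carrier[OF n]]
      by (simp del: index_mult_mat_vec)
  qed simp
  moreover have "(\<zeta> ^ k) ^ n = 1"
    using \<zeta>(1) by (metis power_mult mult.commute power_one)
  ultimately show thesis
    by (intro that[of "\<zeta> ^ k"]) (simp_all add: k ev_def del: complex_cnj_power)
qed

section \<open>Logarithmic affine circulants\<close>

lemma circulant_eq_smult_iff:
  assumes n: "n > 0"
  shows "circulant n \<alpha> = \<beta> \<cdot>\<^sub>m circulant n \<gamma> \<longleftrightarrow> (\<forall>k<n. \<alpha> k = \<beta> * \<gamma> k)"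
proof
  have dim: "dim_row (circulant n \<delta>) = n" "dim_col (circulant n \<delta>) = n" for \<delta>
    using circulant_carrier[OF n] by auto
  {
    assume eq: "circulant n \<alpha> = \<beta> \<cdot>\<^sub>m circulant n \<gamma>"
    have "circulant n \<alpha> $$ (0, k) = \<beta> * circulant n \<gamma> $$ (0, k)" if "k < n" for k
      using that n by (subst eq) (simp add: dim)
    then show "\<forall>k<n. \<alpha> k = \<beta> * \<gamma> k"
      using n by (simp add: circulant_index)
  next
    assume "\<forall>k<n. \<alpha> k = \<beta> * \<gamma> k"
    then show "circulant n \<alpha> = \<beta> \<cdot>\<^sub>m circulant n \<gamma>"
      using n by (intro eq_matI) (auto simp: dim circulant_index)
  }
qed

text \<open>The vector with entries \<open>cnj \<omega> ^ i\<close> is an eigenvector with an eigenvalue of maximal modulus.\<close>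

lemma lp_op_norm_circulant_aligned:
  assumes n: "n > 0" and p: "p \<ge> 1" and \<omega>: "\<omega> ^ n = 1" and \<beta>: "cmod \<beta> = 1"
    and \<alpha>: "\<And>k. k < n \<Longrightarrow> \<alpha> k = \<beta> * (\<omega> ^ k * complex_of_real (cmod (\<alpha> k)))"
  shows "lp_op_norm p (circulant n \<alpha>) = (\<Sum>i<n. cmod (\<alpha> i))"
proof (rule lp_op_norm_eqI[OF circulant_carrier[OF n] n p])
  let ?s = "\<Sum>i<n. cmod (\<alpha> i)"
  define u where "u = vec n (\<lambda>i. cnj \<omega> ^ i)"
  show uc: "u \<in> carrier_vec n" by (simp add: u_def)
  show "lp_norm p u > 0"
    using n p by (intro lp_norm_pos[of 0]) (auto simp: u_def)
  have cnj: "cnj \<omega> ^ n = 1"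
    using \<omega> by (simp flip: complex_cnj_power)
  have unit_pow: "\<omega> ^ k * cnj \<omega> ^ k = 1" for k
    using root_of_unity_mult_cnj[OF \<omega> n] by (simp flip: power_mult_distrib)
  have entry: "\<alpha> k * u $ ((i + k) mod n) = \<beta> * complex_of_real (cmod (\<alpha> k)) * cnj \<omega> ^ i"
    if "k < n" for i k
  proof -
    have "\<alpha> k * u $ ((i + k) mod n)
        = \<beta> * (\<omega> ^ k * complex_of_real (cmod (\<alpha> k))) * cnj \<omega> ^ (i + k)"
      using n \<alpha>[OF that] by (simp add: u_def power_mod_root_of_unity[OF cnj])
    also have "\<dots> = \<beta> * complex_of_real (cmod (\<alpha> k)) * cnj \<omega> ^ i * (\<omega> ^ k * cnj \<omega> ^ k)"
      by (simp only: power_add mult_ac)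
    finally show ?thesis by (simp only: unit_pow mult_1_right)
  qed
  have "circulant n \<alpha> *\<^sub>v u = (\<beta> * complex_of_real ?s) \<cdot>\<^sub>v u"
  proof (rule eq_vecI)
    fix i assume "i < dim_vec ((\<beta> * complex_of_real ?s) \<cdot>\<^sub>v u)"
    then have i: "i < n" using uc by simp
    have "(circulant n \<alpha> *\<^sub>v u) $ i = (\<Sum>k<n. \<beta> * complex_of_real (cmod (\<alpha> k)) * cnj \<omega> ^ i)"
      by (simp add: circulant_mult_vec_index[OF uc i] entry)
    also have "\<dots> = \<beta> * complex_of_real ?s * cnj \<omega> ^ i"
      by (simp add: sum_distrib_left sum_distrib_right)
    finally show "(circulant n \<alpha> *\<^sub>v u) $ i = ((\<beta> * complex_of_real ?s) \<cdot>\<^sub>v u) $ i"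
      using i by (simp add: u_def)
  qed (use uc carrier_matD[OF circulant_carrier[OF n]] in auto)
  moreover have "cmod (\<beta> * complex_of_real ?s) = ?s"
    using \<beta> by (simp only: norm_mult norm_of_real abs_of_nonneg sum_nonneg norm_ge_zero mult_1_left)
  ultimately show "?s * lp_norm p u \<le> lp_norm p (circulant n \<alpha> *\<^sub>v u)"
    using uc n p by (simp add: lp_norm_smult)
qed (use n p lp_norm_circulant_le in auto)

lemma coefficients_aligned_if_lp_op_norm_2:
  assumes n: "n > 0" and norm: "lp_op_norm 2 (circulant n \<alpha>) = (\<Sum>i<n. cmod (\<alpha> i))"
  obtains \<omega> \<beta> where "\<omega> ^ n = 1" and "cmod \<beta> = 1"
    and "\<And>k. k < n \<Longrightarrow> \<alpha> k = \<beta> * (\<omega> ^ k * complex_of_real (cmod (\<alpha> k)))"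
proof -
  obtain \<omega> where \<omega>: "\<omega> ^ n = 1" "lp_op_norm 2 (circulant n \<alpha>) \<le> cmod (\<Sum>i<n. \<alpha> i * cnj \<omega> ^ i)"
    using lp_op_norm_2_circulant_le[OF n] .
  have unit_pow: "cnj \<omega> ^ k * \<omega> ^ k = 1" for k
    using root_of_unity_mult_cnj[OF \<omega>(1) n] by (simp add: mult.commute flip: power_mult_distrib)
  have "cmod \<omega> = 1"
    using power_eq_1_iff[OF \<omega>(1)] n by simp
  then have mod_term: "cmod (\<alpha> k * cnj \<omega> ^ k) = cmod (\<alpha> k)" for k
    by (simp add: norm_mult norm_power)
  then have "(\<Sum>k<n. cmod (\<alpha> k * cnj \<omega> ^ k)) \<le> cmod (\<Sum>k<n. \<alpha> k * cnj \<omega> ^ k)"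
    using \<omega>(2) norm by simp
  then obtain \<beta> where \<beta>: "cmod \<beta> = 1"
    "\<And>k. k \<in> {..<n} \<Longrightarrow> \<alpha> k * cnj \<omega> ^ k = \<beta> * complex_of_real (cmod (\<alpha> k * cnj \<omega> ^ k))"
    using common_phase_if_cmod_sum_ge[of "{..<n}" "\<lambda>k. \<alpha> k * cnj \<omega> ^ k"] by blast
  have "\<alpha> k = \<beta> * (\<omega> ^ k * complex_of_real (cmod (\<alpha> k)))" if "k < n" for k
  proof -
    have "\<alpha> k = \<alpha> k * cnj \<omega> ^ k * \<omega> ^ k"
      using unit_pow[of k] by (simp add: mult.assoc)
    also have "\<dots> = \<beta> * complex_of_real (cmod (\<alpha> k)) * \<omega> ^ k"
      using \<beta>(2)[of k] that unfolding mod_term by simp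
    finally show ?thesis by (simp only: mult_ac)
  qed
  with \<omega>(1) \<beta>(1) show thesis by (rule that)
qed

theorem proposition3p6:
  fixes n :: nat and \<alpha> :: "nat \<Rightarrow> complex" and A :: "complex mat"
  assumes "n \<ge> 1"
    and "A = finsum (module_mat TYPE(complex) n n)
               (\<lambda>i. \<alpha> i \<cdot>\<^sub>m (cyclic_shift n ^\<^sub>m i)) {..<n}"
  shows "(A \<in> LA n \<longleftrightarrow>
            (\<exists>\<omega>::complex. \<omega> ^ n = 1 \<and>
              (\<exists>\<beta>::complex. cmod \<beta> = 1 \<and>
                A = \<beta> \<cdot>\<^sub>m circulant n (\<lambda>i. \<omega> ^ i * complex_of_real (cmod (\<alpha> i))))))
       \<and> (A \<in> LA n \<longrightarrow> (\<forall>p::ereal. p \<ge> 1 \<longrightarrow> lp_op_norm p A = (\<Sum>i<n. cmod (\<alpha> i))))"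
proof -
  have n: "n > 0" using assms(1) by simp
  have A: "A = circulant n \<alpha>" using assms(2) by (simp add: circulant_def)
  let ?aligned = "\<lambda>\<omega> \<beta>. \<forall>k<n. \<alpha> k = \<beta> * (\<omega> ^ k * complex_of_real (cmod (\<alpha> k)))"
  have "A \<in> LA n \<longleftrightarrow> (\<exists>\<omega>. \<omega> ^ n = 1 \<and> (\<exists>\<beta>. cmod \<beta> = 1 \<and> ?aligned \<omega> \<beta>))"
  proof
    assume "A \<in> LA n"
    then have "lp_op_norm 2 (circulant n \<alpha>) = (\<Sum>i<n. cmod (\<alpha> i))"
      by (simp add: A circulant_in_LA_iff[OF n])
    then show "\<exists>\<omega>. \<omega> ^ n = 1 \<and> (\<exists>\<beta>. cmod \<beta> = 1 \<and> ?aligned \<omega> \<beta>)"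
      using coefficients_aligned_if_lp_op_norm_2[OF n] by metis
  next
    assume "\<exists>\<omega>. \<omega> ^ n = 1 \<and> (\<exists>\<beta>. cmod \<beta> = 1 \<and> ?aligned \<omega> \<beta>)"
    then show "A \<in> LA n"
      unfolding A circulant_in_LA_iff[OF n] using lp_op_norm_circulant_aligned[OF n] by blast
  qed
  then show ?thesis
    by (simp add: A circulant_eq_smult_iff[OF n] circulant_in_LA_iff[OF n])
qed

end
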